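(* Let $\mathsf{V}$ be a discriminator variety that is generated, as a variety, by its finite algebras. Assume that $\mathsf{V}$ has a Boolean algebra reduct and that its similarity type is finite. Then for every finite set $X$, the $\mathsf{V}$-free algebra freely generated by $X$ is atomic.
   Context: A similarity type is finite if it has finitely many operation symbols (constants included), each of finite arity. A variety $\mathsf{V}$ is generated by its finite algebras as a variety if $\mathsf{V}$ is the smallest variety containing all finite algebras in $\mathsf{V}$ (equivalently, every equation valid in all finite members of $\mathsf{V}$ is valid in $\mathsf{V}$). A variety $\mathsf{V}$ is a discriminator variety if there is a term $\sigma(x,y,u,v)$ in its language that is a switching term in each subdirectly irreducible member of $\mathsf{V}$, i.e., for all elements $x,y,u,v$ of such a member, $\sigma(x,y,u,v)=u$ if $x=y$, and $\sigma(x,y,u,v)=v$ if $x\ne y$. $\mathsf{V}$ has a Boolean algebra reduct if its similarity type contains operation symbols for the Boolean operations (join $\vee$, meet $\wedge$, complement $-$, and constants $0,1$) such that the reduct of every member of $\mathsf{V}$ to these operations is a Boolean algebra; the similarity type may contain further operation symbols. A member of $\mathsf{V}$ is called atomic if its Boolean algebra reduct is atomic, i.e., every nonzero element $b$ has an atom below it, where an atom is a minimal nonzero element with respect to the Boolean order ($x\le y$ iff $x\wedge y=x$). *)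

theory Defs
  imports "HOL-Library.Countable_Set"
begin

section \<open>Algebras of a similarity type\<close>

text \<open>A similarity type is the type \<open>'f\<close> of its operation symbols together with an arity function
  \<open>ar :: 'f \<Rightarrow> nat\<close>; constants have arity 0.  An algebra is a nonempty set \<open>carrier A\<close> with operations
  on argument lists; the value of \<open>oper A f\<close> matters only on lists of length \<open>ar f\<close> over the
  carrier, and no notion below depends on its other values.\<close>

record ('f, 'u) algebra =
  carrier :: "'u set"
  oper :: "'f \<Rightarrow> 'u list \<Rightarrow> 'u"

definition is_algebra :: "('f \<Rightarrow> nat) \<Rightarrow> ('f, 'u) algebra \<Rightarrow> bool" where
  "is_algebra ar A \<longleftrightarrow> carrier A \<noteq> {} \<and>
     (\<forall>f as. length as = ar f \<and> set as \<subseteq> carrier A \<longrightarrow> oper A f as \<in> carrier A)"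

definition is_hom :: "('f \<Rightarrow> nat) \<Rightarrow> ('f, 'u) algebra \<Rightarrow> ('f, 'w) algebra \<Rightarrow> ('u \<Rightarrow> 'w) \<Rightarrow> bool" where
  "is_hom ar A B h \<longleftrightarrow> h ` carrier A \<subseteq> carrier B \<and>
     (\<forall>f as. length as = ar f \<and> set as \<subseteq> carrier A \<longrightarrow> h (oper A f as) = oper B f (map h as))"

definition is_iso :: "('f \<Rightarrow> nat) \<Rightarrow> ('f, 'u) algebra \<Rightarrow> ('f, 'w) algebra \<Rightarrow> ('u \<Rightarrow> 'w) \<Rightarrow> bool" where
  "is_iso ar A B h \<longleftrightarrow> is_hom ar A B h \<and> bij_betw h (carrier A) (carrier B)"

definition subuniverse :: "('f \<Rightarrow> nat) \<Rightarrow> ('f, 'u) algebra \<Rightarrow> 'u set \<Rightarrow> bool" where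
  "subuniverse ar A S \<longleftrightarrow> S \<subseteq> carrier A \<and>
     (\<forall>f as. length as = ar f \<and> set as \<subseteq> S \<longrightarrow> oper A f as \<in> S)"

definition generated_by :: "('f \<Rightarrow> nat) \<Rightarrow> ('f, 'u) algebra \<Rightarrow> 'u set \<Rightarrow> bool" where
  "generated_by ar A G \<longleftrightarrow> G \<subseteq> carrier A \<and>
     (\<forall>S. subuniverse ar A S \<and> G \<subseteq> S \<longrightarrow> S = carrier A)"

section \<open>Terms, equations and varieties\<close>

datatype ('f, 'v) trm = Var 'v | App 'f "('f, 'v) trm list"

fun wf_trm :: "('f \<Rightarrow> nat) \<Rightarrow> ('f, 'v) trm \<Rightarrow> bool" where
  "wf_trm ar (Var x) \<longleftrightarrow> True"
| "wf_trm ar (App f ts) \<longleftrightarrow> length ts = ar f \<and> (\<forall>t\<in>set ts. wf_trm ar t)"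

primrec vars :: "('f, 'v) trm \<Rightarrow> 'v set" where
  "vars (Var x) = {x}"
| "vars (App f ts) = \<Union> (set (map vars ts))"

primrec trm_value :: "('f, 'u) algebra \<Rightarrow> ('v \<Rightarrow> 'u) \<Rightarrow> ('f, 'v) trm \<Rightarrow> 'u" where
  "trm_value A \<rho> (Var x) = \<rho> x"
| "trm_value A \<rho> (App f ts) = oper A f (map (trm_value A \<rho>) ts)"

type_synonym 'f equation = "('f, nat) trm \<times> ('f, nat) trm"

definition wf_equation :: "('f \<Rightarrow> nat) \<Rightarrow> 'f equation \<Rightarrow> bool" where
  "wf_equation ar e \<longleftrightarrow> wf_trm ar (fst e) \<and> wf_trm ar (snd e)"

definition satisfies :: "('f, 'u) algebra \<Rightarrow> 'f equation \<Rightarrow> bool" where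
  "satisfies A e \<longleftrightarrow>
     (\<forall>\<rho>. range \<rho> \<subseteq> carrier A \<longrightarrow> trm_value A \<rho> (fst e) = trm_value A \<rho> (snd e))"

definition models :: "('f \<Rightarrow> nat) \<Rightarrow> 'f equation set \<Rightarrow> ('f, 'u) algebra set" where
  "models ar E = {A. is_algebra ar A \<and> (\<forall>e\<in>E. satisfies A e)}"

text \<open>Varieties are equational classes.  As HOL has no class of all algebras of arbitrary size, a
  variety is represented by the set of its members whose carrier is a subset of the type \<open>'u\<close>.
  If \<open>'u\<close> is infinite and there are countably many operation symbols, then \<open>'u\<close> has room for
  isomorphic copies of all countable members, in particular of all finite members and of the free
  algebras of countable rank.  Hence such a set determines the equations valid in the variety, and
  all notions below have their usual meaning.  This includes \<open>discriminator_variety\<close>, which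
  quantifies over the subdirectly irreducible members: a term that is a switching term in the
  countable ones is a switching term in all of them.\<close>

definition variety :: "('f \<Rightarrow> nat) \<Rightarrow> ('f, 'u) algebra set \<Rightarrow> bool" where
  "variety ar V \<longleftrightarrow> (\<exists>E. (\<forall>e\<in>E. wf_equation ar e) \<and> V = models ar E)"

definition finite_members :: "('f, 'u) algebra set \<Rightarrow> ('f, 'u) algebra set" where
  "finite_members V = {A \<in> V. finite (carrier A)}"

definition generated_by_finite_members :: "('f \<Rightarrow> nat) \<Rightarrow> ('f, 'u) algebra set \<Rightarrow> bool" where
  "generated_by_finite_members ar V \<longleftrightarrow>
     variety ar V \<and> (\<forall>W. variety ar W \<and> finite_members V \<subseteq> W \<longrightarrow> V \<subseteq> W)"

section \<open>Discriminator varieties\<close>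

text \<open>A subdirect representation of \<open>A\<close> is given as a set of pairs \<open>(B, h)\<close> of factors \<open>B\<close> and
  component maps \<open>h\<close> of a subdirect embedding of \<open>A\<close> into the product of the factors: each
  component is onto, and the components jointly separate the points of \<open>A\<close>.  Repetitions in an
  indexed family are irrelevant, and the factors, being images of \<open>A\<close>, can be taken to live in
  the same type as \<open>A\<close>.\<close>

definition subdirect_representation ::
    "('f \<Rightarrow> nat) \<Rightarrow> ('f, 'u) algebra \<Rightarrow> (('f, 'u) algebra \<times> ('u \<Rightarrow> 'u)) set \<Rightarrow> bool" where
  "subdirect_representation ar A R \<longleftrightarrow>
     (\<forall>(B, h)\<in>R. is_algebra ar B \<and> is_hom ar A B h \<and> h ` carrier A = carrier B) \<and>
     (\<forall>a\<in>carrier A. \<forall>b\<in>carrier A. (\<forall>(B, h)\<in>R. h a = h b) \<longrightarrow> a = b)"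

text \<open>The empty representation is allowed, so the trivial algebra does not count as subdirectly
  irreducible.  Every term is a switching term in the trivial algebra, so this convention has no
  influence on what a discriminator variety is.\<close>

definition subdirectly_irreducible :: "('f \<Rightarrow> nat) \<Rightarrow> ('f, 'u) algebra \<Rightarrow> bool" where
  "subdirectly_irreducible ar A \<longleftrightarrow> is_algebra ar A \<and>
     (\<forall>R. subdirect_representation ar A R \<longrightarrow> (\<exists>(B, h)\<in>R. is_iso ar A B h))"

text \<open>The variables \<open>x, y, u, v\<close> of a switching term are the variables \<open>0, 1, 2, 3\<close>.\<close>

definition switching_term :: "('f, 'u) algebra \<Rightarrow> ('f, nat) trm \<Rightarrow> bool" where
  "switching_term A \<sigma> \<longleftrightarrow>
     (\<forall>x\<in>carrier A. \<forall>y\<in>carrier A. \<forall>u\<in>carrier A. \<forall>v\<in>carrier A.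
        trm_value A (\<lambda>n. [x, y, u, v] ! n) \<sigma> = (if x = y then u else v))"

definition discriminator_variety :: "('f \<Rightarrow> nat) \<Rightarrow> ('f, 'u) algebra set \<Rightarrow> bool" where
  "discriminator_variety ar V \<longleftrightarrow> variety ar V \<and>
     (\<exists>\<sigma>. wf_trm ar \<sigma> \<and> vars \<sigma> \<subseteq> {0, 1, 2, 3} \<and>
        (\<forall>A\<in>V. subdirectly_irreducible ar A \<longrightarrow> switching_term A \<sigma>))"

section \<open>Boolean reducts and atomicity\<close>

definition boolean_algebra_on ::
    "'u set \<Rightarrow> ('u \<Rightarrow> 'u \<Rightarrow> 'u) \<Rightarrow> ('u \<Rightarrow> 'u \<Rightarrow> 'u) \<Rightarrow> ('u \<Rightarrow> 'u) \<Rightarrow> 'u \<Rightarrow> 'u \<Rightarrow> bool" where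
  "boolean_algebra_on C join meet compl zero one \<longleftrightarrow>
     zero \<in> C \<and> one \<in> C \<and>
     (\<forall>x\<in>C. compl x \<in> C) \<and>
     (\<forall>x\<in>C. \<forall>y\<in>C. join x y \<in> C \<and> meet x y \<in> C) \<and>
     (\<forall>x\<in>C. \<forall>y\<in>C. join x y = join y x \<and> meet x y = meet y x) \<and>
     (\<forall>x\<in>C. \<forall>y\<in>C. \<forall>z\<in>C. join (join x y) z = join x (join y z) \<and>
                         meet (meet x y) z = meet x (meet y z)) \<and>
     (\<forall>x\<in>C. \<forall>y\<in>C. join x (meet x y) = x \<and> meet x (join x y) = x) \<and>
     (\<forall>x\<in>C. \<forall>y\<in>C. \<forall>z\<in>C. meet x (join y z) = join (meet x y) (meet x z) \<and>
                         join x (meet y z) = meet (join x y) (join x z)) \<and>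
     (\<forall>x\<in>C. join x zero = x \<and> meet x one = x) \<and>
     (\<forall>x\<in>C. join x (compl x) = one \<and> meet x (compl x) = zero)"

definition has_boolean_reduct ::
    "('f \<Rightarrow> nat) \<Rightarrow> ('f, 'u) algebra set \<Rightarrow> 'f \<Rightarrow> 'f \<Rightarrow> 'f \<Rightarrow> 'f \<Rightarrow> 'f \<Rightarrow> bool" where
  "has_boolean_reduct ar V jn mt cm zr on \<longleftrightarrow>
     ar jn = 2 \<and> ar mt = 2 \<and> ar cm = 1 \<and> ar zr = 0 \<and> ar on = 0 \<and>
     (\<forall>A\<in>V. boolean_algebra_on (carrier A)
        (\<lambda>x y. oper A jn [x, y]) (\<lambda>x y. oper A mt [x, y]) (\<lambda>x. oper A cm [x])
        (oper A zr []) (oper A on []))"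

text \<open>The Boolean order is determined by the meet symbol \<open>mt\<close>, and its least element is the
  constant \<open>zr\<close>.\<close>

definition bool_le :: "'f \<Rightarrow> ('f, 'u) algebra \<Rightarrow> 'u \<Rightarrow> 'u \<Rightarrow> bool" where
  "bool_le mt A x y \<longleftrightarrow> oper A mt [x, y] = x"

definition is_atom :: "'f \<Rightarrow> 'f \<Rightarrow> ('f, 'u) algebra \<Rightarrow> 'u \<Rightarrow> bool" where
  "is_atom mt zr A a \<longleftrightarrow> a \<in> carrier A \<and> a \<noteq> oper A zr [] \<and>
     (\<forall>x\<in>carrier A. x \<noteq> oper A zr [] \<and> bool_le mt A x a \<longrightarrow> x = a)"

definition atomic :: "'f \<Rightarrow> 'f \<Rightarrow> ('f, 'u) algebra \<Rightarrow> bool" where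
  "atomic mt zr A \<longleftrightarrow>
     (\<forall>b\<in>carrier A. b \<noteq> oper A zr [] \<longrightarrow> (\<exists>a. is_atom mt zr A a \<and> bool_le mt A a b))"

section \<open>Free algebras\<close>

text \<open>\<open>F\<close> is the \<open>V\<close>-free algebra freely generated by \<open>X\<close>, where \<open>\<eta>\<close> places the free generators
  in \<open>F\<close>.  The map \<open>\<eta>\<close> is injective on \<open>X\<close> as soon as \<open>V\<close> has a nontrivial member.\<close>

definition free_algebra ::
    "('f \<Rightarrow> nat) \<Rightarrow> ('f, 'u) algebra set \<Rightarrow> 'x set \<Rightarrow> ('x \<Rightarrow> 'u) \<Rightarrow> ('f, 'u) algebra \<Rightarrow> bool" where
  "free_algebra ar V X \<eta> F \<longleftrightarrow>
     F \<in> V \<and> generated_by ar F (\<eta> ` X) \<and>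
     (\<forall>A\<in>V. \<forall>g. g ` X \<subseteq> carrier A \<longrightarrow> (\<exists>h. is_hom ar F A h \<and> (\<forall>x\<in>X. h (\<eta> x) = g x)))"

text \<open>In an infinite type there is room for the free algebra, so \<open>free_algebra\<close> is not vacuous: it
  is realised by a copy of the algebra of terms over \<open>X\<close> modulo the equations valid in \<open>V\<close>.  A
  constant symbol \<open>c\<close> ensures that there is at least one term, also if \<open>X\<close> is empty.\<close>

primrec trm_subst :: "('v \<Rightarrow> ('f, 'w) trm) \<Rightarrow> ('f, 'v) trm \<Rightarrow> ('f, 'w) trm" where
  "trm_subst \<theta> (Var x) = \<theta> x"
| "trm_subst \<theta> (App f ts) = App f (map (trm_subst \<theta>) ts)"

lemma trm_value_subst: "trm_value A \<tau> (trm_subst \<theta> t) = trm_value A (\<lambda>n. trm_value A \<tau> (\<theta> n)) t"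
  by (induction t) (auto simp: comp_def cong: map_cong)

lemma countable_trms: "countable (UNIV :: (nat, nat) trm set)"
proof -
  define S where "S = rec_nat (range Var :: (nat, nat) trm set)
    (\<lambda>_ S. S \<union> (\<lambda>(f, ts). App f ts) ` (UNIV \<times> lists S))"
  have S0: "S 0 = range Var" and
    SS: "S (Suc n) = S n \<union> (\<lambda>(f, ts). App f ts) ` (UNIV \<times> lists (S n))" for n
    by (simp_all add: S_def)
  have c: "countable (S n)" for n
    by (induction n) (simp_all add: S0 SS)
  have mono: "m \<le> n \<Longrightarrow> S m \<subseteq> S n" for m n
    by (rule lift_Suc_mono_le[of S]) (auto simp: SS)
  have "\<exists>n. t \<in> S n" for t
  proof (induction t)
    case (Var x)
    show ?case by (rule exI[of _ 0]) (simp add: S0)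
  next
    case (App f ts)
    then obtain k where k: "\<forall>t\<in>set ts. t \<in> S (k t)" by metis
    define n where "n = Max (insert 0 (k ` set ts))"
    have "k t \<le> n" if "t \<in> set ts" for t
      using that unfolding n_def by (intro Max_ge) auto
    then have "ts \<in> lists (S n)" using k mono by blast
    then have "App f ts \<in> S (Suc n)" by (auto simp: SS)
    then show ?case ..
  qed
  then have "UNIV = (\<Union>n. S n)" by auto
  then show ?thesis using c by (metis countable_UN countableI_type)
qed

lemma free_algebra_exists:
  fixes ar :: "'f \<Rightarrow> nat" and V :: "('f, 'u) algebra set" and X :: "'x set"
  assumes inf: "infinite (UNIV :: 'u set)" and cf: "countable (UNIV :: 'f set)"
    and cX: "countable X" and c: "ar c = 0" and V: "variety ar V"
  shows "\<exists>\<eta> F. free_algebra ar V X \<eta> F"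
proof -
  obtain E where E: "\<And>e. e \<in> E \<Longrightarrow> wf_equation ar e" and VE: "V = models ar E"
    using V unfolding variety_def by blast
  define T where "T = {t :: ('f, 'x) trm. wf_trm ar t \<and> vars t \<subseteq> X}"
  have TApp: "App f ts \<in> T \<longleftrightarrow> length ts = ar f \<and> set ts \<subseteq> T" for f ts
    unfolding T_def by auto
  have TVar: "Var x \<in> T \<longleftrightarrow> x \<in> X" for x unfolding T_def by auto
  have "countable T"
  proof -
    define m where "m = map_trm (to_nat_on (UNIV :: 'f set)) (to_nat_on X)"
    have setv: "set2_trm t = vars t" for t :: "('f, 'x) trm" by (induction t) auto
    have "inj_on m T"
    proof (rule inj_onI)
      fix s t assume "s \<in> T" "t \<in> T" "m s = m t"
      then show "s = t"
        unfolding m_def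
        by (intro trm.inj_map_strong[of s t])
          (auto simp: setv T_def dest: inj_onD[OF inj_on_to_nat_on[OF cf]]
             inj_onD[OF inj_on_to_nat_on[OF cX]])
    qed
    moreover have "countable (m ` T)"
      by (rule countable_subset[OF _ countable_trms]) simp
    ultimately show ?thesis by (rule countable_image_inj_on[rotated])
  qed
  obtain e :: "nat \<Rightarrow> 'u" where e: "inj e" 
    using inf unfolding infinite_iff_countable_subset by auto
  define code where "code t = e (to_nat_on T t)" for t
  have code: "inj_on code T"
    unfolding code_def using inj_on_to_nat_on[OF \<open>countable T\<close>] e
    by (auto simp: inj_on_def)
  define eqv where "eqv s t \<longleftrightarrow> (\<forall>A\<in>V. \<forall>\<rho>. \<rho> ` X \<subseteq> carrier A \<longrightarrow> trm_value A \<rho> s = trm_value A \<rho> t)"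
    for s t :: "('f, 'x) trm"
  have eqv_refl: "eqv t t" and eqv_sym: "eqv s t \<Longrightarrow> eqv t s"
    and eqv_trans: "eqv s t \<Longrightarrow> eqv t r \<Longrightarrow> eqv s r" for s t r
    unfolding eqv_def by auto
  define rep where "rep t = (SOME s. s \<in> T \<and> eqv s t)" for t
  have rep: "rep t \<in> T \<and> eqv (rep t) t" if "t \<in> T" for t
    unfolding rep_def by (rule someI[of _ t]) (use that eqv_refl in auto)
  have rep_eq: "rep s = rep t \<longleftrightarrow> eqv s t" if "s \<in> T" "t \<in> T" for s t
  proof
    assume "rep s = rep t"
    then show "eqv s t" using rep that eqv_sym eqv_trans by metis
  next
    assume "eqv s t"
    then have "(\<lambda>r. r \<in> T \<and> eqv r s) = (\<lambda>r. r \<in> T \<and> eqv r t)"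
      using eqv_sym eqv_trans by blast
    then show "rep s = rep t" unfolding rep_def by simp
  qed
  define q where "q t = code (rep t)" for t
  have q_eq: "q s = q t \<longleftrightarrow> eqv s t" if "s \<in> T" "t \<in> T" for s t
    unfolding q_def using rep_eq[OF that] inj_on_eq_iff[OF code] rep that by metis
  define pick where "pick a = (SOME t. t \<in> T \<and> q t = a)" for a
  have pick: "pick a \<in> T \<and> q (pick a) = a" if "a \<in> q ` T" for a
    unfolding pick_def by (rule someI_ex) (use that in auto)
  define F where "F = \<lparr>carrier = q ` T, oper = (\<lambda>f as. q (App f (map pick as)))\<rparr>"
  have cF: "carrier F = q ` T" and oF: "oper F f as = q (App f (map pick as))" for f as
    unfolding F_def by simp_all
  have mapT: "App f (map pick as) \<in> T" if "length as = ar f" "set as \<subseteq> q ` T" for f as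
    using that pick by (auto simp: TApp)
  have algV: "is_algebra ar A" if "A \<in> V" for A using that unfolding VE models_def by auto
  have val_in: "trm_value A \<rho> t \<in> carrier A" if "A \<in> V" "\<rho> ` X \<subseteq> carrier A" "t \<in> T" for A \<rho> t
    using that(3)
  proof (induction t)
    case (Var x)
    then show ?case using that(2) by (auto simp: TVar)
  next
    case (App f ts)
    then have "length (map (trm_value A \<rho>) ts) = ar f"
      "set (map (trm_value A \<rho>) ts) \<subseteq> carrier A"
      by (auto simp: TApp)
    then show ?case using algV[OF that(1)] unfolding is_algebra_def trm_value.simps by blast
  qed
  have eqv_App: "eqv (App f ss) (App f ts)" if "list_all2 eqv ss ts" for f ss ts
  proof -
    have "map (trm_value A \<rho>) ss = map (trm_value A \<rho>) ts" if "A \<in> V" "\<rho> ` X \<subseteq> carrier A" for A \<rho>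
      using \<open>list_all2 eqv ss ts\<close> by (induction rule: list_all2_induct) (use that in \<open>auto simp: eqv_def\<close>)
    then show ?thesis unfolding eqv_def by simp
  qed
  have qApp: "oper F f (map q ts) = q (App f ts)" if "App f ts \<in> T" for f ts
  proof -
    have ts: "length ts = ar f" "set ts \<subseteq> T" using that by (auto simp: TApp)
    have "eqv (pick (q t)) t" if "t \<in> T" for t
      using pick[of "q t"] q_eq[of "pick (q t)" t] that by auto
    then have "list_all2 eqv (map pick (map q ts)) ts"
      using ts by (auto simp: list_all2_conv_all_nth subset_iff)
    moreover have "App f (map pick (map q ts)) \<in> T" by (rule mapT) (use ts in auto)
    ultimately show ?thesis unfolding oF using q_eq eqv_App that by blast
  qed
  have algF: "is_algebra ar F"
  proof -
    have "App c [] \<in> T" using c by (simp add: TApp)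
    then show ?thesis unfolding is_algebra_def cF oF using mapT by blast
  qed
  have valF: "trm_value F \<rho> s = q (trm_subst (\<lambda>n. pick (\<rho> n)) s) \<and> trm_subst (\<lambda>n. pick (\<rho> n)) s \<in> T"
    if "wf_trm ar s" and \<rho>: "range \<rho> \<subseteq> q ` T" for s :: "('f, nat) trm" and \<rho>
    using that(1)
  proof (induction s)
    case (Var x)
    have "\<rho> x \<in> q ` T" using \<rho> by blast
    then show ?case using pick[of "\<rho> x"] by simp
  next
    case (App f ts)
    let ?ts = "map (trm_subst (\<lambda>n. pick (\<rho> n))) ts"
    have T: "App f ?ts \<in> T" using App by (auto simp: TApp)
    have "map (trm_value F \<rho>) ts = map q ?ts" using App by auto
    then have "trm_value F \<rho> (App f ts) = oper F f (map q ?ts)" by (simp only: trm_value.simps)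
    then show ?case using qApp[OF T] T by simp
  qed
  have "F \<in> V"
  proof -
    have "satisfies F eq" if "eq \<in> E" for eq
      unfolding satisfies_def
    proof (intro allI impI)
      fix \<rho> :: "nat \<Rightarrow> 'u" assume "range \<rho> \<subseteq> carrier F"
      then have \<rho>: "range \<rho> \<subseteq> q ` T" by (simp add: cF)
      have wf: "wf_trm ar (fst eq)" "wf_trm ar (snd eq)"
        using E[OF that] unfolding wf_equation_def by auto
      have "eqv (trm_subst (\<lambda>n. pick (\<rho> n)) (fst eq)) (trm_subst (\<lambda>n. pick (\<rho> n)) (snd eq))"
        unfolding eqv_def trm_value_subst
      proof (intro ballI allI impI)
        fix A :: "('f, 'u) algebra" and \<tau> assume A: "A \<in> V" "\<tau> ` X \<subseteq> carrier A"
        have "range (\<lambda>n. trm_value A \<tau> (pick (\<rho> n))) \<subseteq> carrier A"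
          using val_in[OF A] pick \<rho> by (auto simp: image_subset_iff)
        then show "trm_value A (\<lambda>n. trm_value A \<tau> (pick (\<rho> n))) (fst eq) =
            trm_value A (\<lambda>n. trm_value A \<tau> (pick (\<rho> n))) (snd eq)"
          using A(1) that unfolding VE models_def satisfies_def by blast
      qed
      then show "trm_value F \<rho> (fst eq) = trm_value F \<rho> (snd eq)"
        using valF[OF wf(1) \<rho>] valF[OF wf(2) \<rho>] q_eq by auto
    qed
    then show ?thesis using algF unfolding VE models_def by auto
  qed
  define \<eta> where "\<eta> x = q (Var x)" for x
  have gen: "generated_by ar F (\<eta> ` X)"
    unfolding generated_by_def
  proof (intro conjI allI impI)
    show "\<eta> ` X \<subseteq> carrier F" by (auto simp: cF \<eta>_def TVar)
    fix S assume S: "subuniverse ar F S \<and> \<eta> ` X \<subseteq> S"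
    have "q t \<in> S" if "t \<in> T" for t
      using that
    proof (induction t)
      case (Var x)
      then show ?case using S by (auto simp: TVar \<eta>_def)
    next
      case (App f ts)
      then have "length (map q ts) = ar f" "set (map q ts) \<subseteq> S" by (auto simp: TApp)
      then have "oper F f (map q ts) \<in> S" using S unfolding subuniverse_def by blast
      then show ?case using qApp[OF App.prems] by simp
    qed
    then show "S = carrier F" using S unfolding subuniverse_def cF by auto
  qed
  have "\<exists>h. is_hom ar F A h \<and> (\<forall>x\<in>X. h (\<eta> x) = g x)" if A: "A \<in> V" "g ` X \<subseteq> carrier A" for A g
  proof -
    define h where "h a = trm_value A g (pick a)" for a
    have hq: "h (q t) = trm_value A g t" if "t \<in> T" for t
      using pick[of "q t"] q_eq[of "pick (q t)" t] that A unfolding h_def eqv_def by auto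
    have "is_hom ar F A h"
      unfolding is_hom_def cF
    proof (intro conjI allI impI)
      show "h ` q ` T \<subseteq> carrier A" using hq val_in[OF A] by auto
      fix f as assume as: "length as = ar f \<and> set as \<subseteq> q ` T"
      have "map h as = map (trm_value A g) (map pick as)" by (simp add: h_def)
      then show "h (oper F f as) = oper A f (map h as)"
        unfolding oF using hq[OF mapT, of "as" f] as by (simp only: trm_value.simps)
    qed
    moreover have "\<forall>x\<in>X. h (\<eta> x) = g x" using hq by (auto simp: \<eta>_def TVar)
    ultimately show ?thesis by blast
  qed
  then have "free_algebra ar V X \<eta> F" using \<open>F \<in> V\<close> gen unfolding free_algebra_def by blast
  then show ?thesis by blast
qed

end

theory Submission
  imports Defs
begin

text \<open>Let \<open>b\<close> be a nonzero element of the free algebra \<open>F\<close>.  Being generated by its finite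
  members, \<open>V\<close> has a finite member \<open>A\<close> and a homomorphism \<open>h : F \<rightarrow> A\<close> with \<open>h b \<noteq> 0\<close>: write \<open>b\<close>
  as the value of a term \<open>t\<close> in the generators and refute the equation \<open>t = 0\<close> in a finite member
  (\<open>free_algebra_separated_by_finite_members\<close>).  The finite Boolean algebra \<open>h(F)\<close> has an atom
  \<open>a \<le> h b\<close>, which now has to be lifted to \<open>F\<close>.

  Since \<open>h(F)\<close> is finite, its multiplication table is described by finitely many pairs of elements
  of \<open>F\<close>, because there are only finitely many generators and operation symbols.  So the kernel of
  \<open>h\<close> is the least congruence containing some finite set \<open>P\<close> of pairs
  (\<open>finite_quotient_finitely_presented\<close>).  The discriminator turns this finite set of equations into
  a single element: with \<open>\<sigma>\<close> the switching term, the meet \<open>d\<close> of all \<open>\<sigma>(p, q, 1, 0)\<close> with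
  \<open>(p, q) \<in> P\<close> is mapped by any homomorphism \<open>\<pi>\<close> to a subdirectly irreducible member to \<open>1\<close> if
  \<open>\<pi>\<close> identifies all pairs in \<open>P\<close>, and to \<open>0\<close> otherwise (\<open>ex_equality_test\<close>).

  Choose \<open>z\<close> with \<open>h z = a\<close>.  Then \<open>c = d \<and> z\<close> is an atom below \<open>b\<close>.  Indeed, by Birkhoff's subdirect
  representation theorem, elements of \<open>F\<close> can be compared through the maps \<open>\<pi>\<close> to subdirectly
  irreducible members (\<open>eq_if_eq_in_subdirectly_irreducibles\<close>).  If \<open>\<pi>\<close> does not identify all of
  \<open>P\<close>, it kills \<open>c\<close> and everything below it.  Otherwise \<open>\<pi>\<close> factors through \<open>h\<close>, so that the relation
  of \<open>c\<close> to other elements is decided in \<open>h(F)\<close>, where \<open>h c = a\<close> is an atom below \<open>h b\<close>.\<close>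

section \<open>Term values and homomorphisms\<close>

lemma trm_value_cong_vars:
  assumes "\<And>x. x \<in> vars t \<Longrightarrow> \<rho> x = \<rho>' x"
  shows "trm_value A \<rho> t = trm_value A \<rho>' t"
  using assms
proof (induction t)
  case (App f ts)
  have "trm_value A \<rho> t = trm_value A \<rho>' t" if "t \<in> set ts" for t
    using App.IH[OF that] App.prems that by auto
  then have "map (trm_value A \<rho>) ts = map (trm_value A \<rho>') ts" by simp
  then show ?case by (simp only: trm_value.simps)
qed simp

lemma oper_in_carrier:
  assumes "is_algebra ar A" "length as = ar f" "set as \<subseteq> carrier A"
  shows "oper A f as \<in> carrier A"
  using assms unfolding is_algebra_def by blast

lemma hom_in_carrier: "is_hom ar A B h \<Longrightarrow> a \<in> carrier A \<Longrightarrow> h a \<in> carrier B"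
  unfolding is_hom_def by blast

lemma hom_oper:
  assumes "is_hom ar A B h" "length as = ar f" "set as \<subseteq> carrier A"
  shows "h (oper A f as) = oper B f (map h as)"
  using assms unfolding is_hom_def by blast

lemma hom_comp:
  assumes h: "is_hom ar A B h" and g: "is_hom ar B C g"
  shows "is_hom ar A C (g \<circ> h)"
  unfolding is_hom_def
proof (intro conjI allI impI)
  show "(g \<circ> h) ` carrier A \<subseteq> carrier C"
    using hom_in_carrier[OF h] hom_in_carrier[OF g] by auto
  fix f as assume as: "length as = ar f \<and> set as \<subseteq> carrier A"
  then have "set (map h as) \<subseteq> carrier B" using hom_in_carrier[OF h] by auto
  then show "(g \<circ> h) (oper A f as) = oper C f (map (g \<circ> h) as)"
    using hom_oper[OF h] hom_oper[OF g, of "map h as"] as by simp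
qed

lemma trm_value_in_carrier:
  assumes "is_algebra ar A" "wf_trm ar t" "\<And>x. x \<in> vars t \<Longrightarrow> \<rho> x \<in> carrier A"
  shows "trm_value A \<rho> t \<in> carrier A"
  using assms(2,3)
proof (induction t)
  case (App f ts)
  have "trm_value A \<rho> t \<in> carrier A" if "t \<in> set ts" for t
    using App.IH[OF that] App.prems that by auto
  then show ?case using App.prems(1) by (auto intro!: oper_in_carrier[OF assms(1)])
qed simp

lemma hom_trm_value:
  assumes "is_algebra ar A" "is_hom ar A B h" "wf_trm ar t"
    and "\<And>x. x \<in> vars t \<Longrightarrow> \<rho> x \<in> carrier A"
  shows "h (trm_value A \<rho> t) = trm_value B (h \<circ> \<rho>) t"
  using assms(3,4)
proof (induction t)
  case (App f ts)
  have vs: "trm_value A \<rho> t \<in> carrier A" "h (trm_value A \<rho> t) = trm_value B (h \<circ> \<rho>) t"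
    if "t \<in> set ts" for t
  proof -
    have prems: "wf_trm ar t" "\<And>x. x \<in> vars t \<Longrightarrow> \<rho> x \<in> carrier A" using App.prems that by auto
    show "trm_value A \<rho> t \<in> carrier A" by (rule trm_value_in_carrier[OF assms(1) prems])
    show "h (trm_value A \<rho> t) = trm_value B (h \<circ> \<rho>) t" by (rule App.IH[OF that prems])
  qed
  have "h (oper A f (map (trm_value A \<rho>) ts)) = oper B f (map h (map (trm_value A \<rho>) ts))"
    using App.prems(1) vs(1) by (intro hom_oper[OF assms(2)]) auto
  also have "map h (map (trm_value A \<rho>) ts) = map (trm_value B (h \<circ> \<rho>)) ts"
    using vs(2) by simp
  finally show ?case by (simp only: trm_value.simps)
qed simp

lemma variety_is_algebra: "variety ar V \<Longrightarrow> A \<in> V \<Longrightarrow> is_algebra ar A"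
  unfolding variety_def models_def by auto

lemma hom_image_in_variety:
  assumes V: "variety ar V" and A: "A \<in> V" and B: "is_algebra ar B"
    and h: "is_hom ar A B h" and onto: "h ` carrier A = carrier B"
  shows "B \<in> V"
proof -
  obtain E where E: "\<And>e. e \<in> E \<Longrightarrow> wf_equation ar e" and VE: "V = models ar E"
    using V unfolding variety_def by blast
  have algA: "is_algebra ar A" using variety_is_algebra[OF V A] .
  have "satisfies B e" if e: "e \<in> E" for e
    unfolding satisfies_def
  proof (intro allI impI)
    fix \<rho> :: "nat \<Rightarrow> _" assume \<rho>: "range \<rho> \<subseteq> carrier B"
    define \<rho>' where "\<rho>' n = inv_into (carrier A) h (\<rho> n)" for n
    have \<rho>'A: "\<rho>' n \<in> carrier A" and h\<rho>': "h (\<rho>' n) = \<rho> n" for n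
      using \<rho> onto unfolding \<rho>'_def by (auto intro!: inv_into_into f_inv_into_f)
    have "h \<circ> \<rho>' = \<rho>" using h\<rho>' by auto
    then have "trm_value B \<rho> t = h (trm_value A \<rho>' t)" if "wf_trm ar t" for t
      using hom_trm_value[OF algA h that] \<rho>'A by metis
    moreover have "trm_value A \<rho>' (fst e) = trm_value A \<rho>' (snd e)"
      using A e \<rho>'A unfolding VE models_def satisfies_def by blast
    ultimately show "trm_value B \<rho> (fst e) = trm_value B \<rho> (snd e)"
      using E[OF e] unfolding wf_equation_def by metis
  qed
  then show ?thesis using B unfolding VE models_def by blast
qed

lemma generated_by_induct:
  assumes gen: "generated_by ar A G" and a: "a \<in> carrier A"
    and alg: "is_algebra ar A"
    and base: "\<And>g. g \<in> G \<Longrightarrow> P g"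
    and step: "\<And>f as. length as = ar f \<Longrightarrow> set as \<subseteq> carrier A \<Longrightarrow>
      (\<And>a. a \<in> set as \<Longrightarrow> P a) \<Longrightarrow> P (oper A f as)"
  shows "P a"
proof -
  have "subuniverse ar A {a \<in> carrier A. P a}"
    unfolding subuniverse_def using step oper_in_carrier[OF alg]
    by (auto simp: subset_iff)
  moreover have "G \<subseteq> {a \<in> carrier A. P a}" using gen base unfolding generated_by_def by auto
  ultimately have "{a \<in> carrier A. P a} = carrier A" using gen unfolding generated_by_def by blast
  then show ?thesis using a by blast
qed

section \<open>Congruences and subdirectly irreducible quotients\<close>

definition congruence :: "('f \<Rightarrow> nat) \<Rightarrow> ('f, 'u) algebra \<Rightarrow> ('u \<times> 'u) set \<Rightarrow> bool" where
  "congruence ar A \<theta> \<longleftrightarrow> equiv (carrier A) \<theta> \<and>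
     (\<forall>f as bs. length as = ar f \<and> list_all2 (\<lambda>a b. (a, b) \<in> \<theta>) as bs \<longrightarrow>
        (oper A f as, oper A f bs) \<in> \<theta>)"

definition hom_kernel :: "('f, 'u) algebra \<Rightarrow> ('u \<Rightarrow> 'w) \<Rightarrow> ('u \<times> 'u) set" where
  "hom_kernel A h = {(a, b). a \<in> carrier A \<and> b \<in> carrier A \<and> h a = h b}"

lemma congruence_subset: "congruence ar A \<theta> \<Longrightarrow> \<theta> \<subseteq> carrier A \<times> carrier A"
  unfolding congruence_def equiv_def refl_on_def by blast

lemma list_all2_in_carrier:
  assumes "list_all2 (\<lambda>a b. (a, b) \<in> \<theta>) as bs" "\<theta> \<subseteq> C \<times> C"
  shows "set as \<subseteq> C" "set bs \<subseteq> C"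
  using assms by (induction rule: list_all2_induct) auto

lemma congruence_hom_kernel:
  assumes A: "is_algebra ar A" and h: "is_hom ar A B h"
  shows "congruence ar A (hom_kernel A h)"
  unfolding congruence_def
proof (intro conjI allI impI)
  show "equiv (carrier A) (hom_kernel A h)"
    unfolding equiv_def refl_on_def sym_def trans_def hom_kernel_def by auto
  fix f as bs assume *: "length as = ar f \<and> list_all2 (\<lambda>a b. (a, b) \<in> hom_kernel A h) as bs"
  then have "length bs = ar f" by (auto dest: list_all2_lengthD)
  moreover have "hom_kernel A h \<subseteq> carrier A \<times> carrier A" unfolding hom_kernel_def by auto
  then have "set as \<subseteq> carrier A" "set bs \<subseteq> carrier A"
    using list_all2_in_carrier[OF conjunct2[OF *]] by simp_all
  moreover from * have "list_all2 (\<lambda>a b. (a, b) \<in> hom_kernel A h) as bs" ..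
  then have "map h as = map h bs"
    by (induction rule: list_all2_induct) (auto simp: hom_kernel_def)
  ultimately show "(oper A f as, oper A f bs) \<in> hom_kernel A h"
    using * unfolding hom_kernel_def
    by (auto simp: hom_oper[OF h] intro!: oper_in_carrier[OF A])
qed

text \<open>Compatibility survives directed unions because operations are finitary: the finitely many pairs
  of arguments already lie in one member of the chain.\<close>

lemma congruence_Union_chain:
  assumes ne: "C \<noteq> {}" and cong: "\<And>\<theta>. \<theta> \<in> C \<Longrightarrow> congruence ar A \<theta>"
    and chain: "subset.chain UNIV C"
  shows "congruence ar A (\<Union>C)"
  unfolding congruence_def
proof (intro conjI allI impI)
  have eq: "equiv (carrier A) \<theta>" if "\<theta> \<in> C" for \<theta>
    using cong[OF that] unfolding congruence_def by (rule conjunct1)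
  have dir: "\<theta> \<subseteq> \<theta>' \<or> \<theta>' \<subseteq> \<theta>" if "\<theta> \<in> C" "\<theta>' \<in> C" for \<theta> \<theta>'
    using chain that unfolding subset.chain_def by auto
  have "trans (\<Union>C)"
  proof (rule transI)
    fix a b c assume "(a, b) \<in> \<Union>C" "(b, c) \<in> \<Union>C"
    then obtain \<theta> \<theta>' where C: "\<theta> \<in> C" "(a, b) \<in> \<theta>" "\<theta>' \<in> C" "(b, c) \<in> \<theta>'" by (elim UnionE)
    from dir[OF C(1,3)] obtain \<theta>'' where "\<theta>'' \<in> C" "(a, b) \<in> \<theta>''" "(b, c) \<in> \<theta>''" using C by auto
    then have "(a, c) \<in> \<theta>''" using eq by (meson equivE transE)
    then show "(a, c) \<in> \<Union>C" using \<open>\<theta>'' \<in> C\<close> by (rule UnionI[rotated])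
  qed
  moreover have "refl_on (carrier A) (\<Union>C)"
  proof (rule refl_onI)
    fix a assume a: "a \<in> carrier A"
    obtain \<theta> where "\<theta> \<in> C" using ne by auto
    then have "(a, a) \<in> \<theta>" using eq a by (meson equivE refl_onD)
    then show "(a, a) \<in> \<Union>C" using \<open>\<theta> \<in> C\<close> by (rule UnionI[rotated])
  qed
  moreover have "\<Union>C \<subseteq> carrier A \<times> carrier A"
    by (rule Union_least) (rule congruence_subset[OF cong])
  moreover have "sym (\<Union>C)"
  proof (rule symI)
    fix a b assume "(a, b) \<in> \<Union>C"
    then obtain \<theta> where "\<theta> \<in> C" "(a, b) \<in> \<theta>" by (elim UnionE)
    then have "(b, a) \<in> \<theta>" using eq by (meson equivE symE)
    then show "(b, a) \<in> \<Union>C" using \<open>\<theta> \<in> C\<close> by (rule UnionI[rotated])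
  qed
  ultimately show "equiv (carrier A) (\<Union>C)" by (intro equivI)
  fix f as bs assume *: "length as = ar f \<and> list_all2 (\<lambda>a b. (a, b) \<in> \<Union>C) as bs"
  have "set (zip as bs) \<subseteq> \<Union>C" using * unfolding list_all2_iff by auto
  then obtain \<theta> where "\<theta> \<in> C" "set (zip as bs) \<subseteq> \<theta>"
    using finite_subset_Union_chain[OF finite_set _ ne chain] by metis
  then have "list_all2 (\<lambda>a b. (a, b) \<in> \<theta>) as bs" using * unfolding list_all2_iff by auto
  then have "(oper A f as, oper A f bs) \<in> \<theta>"
    using * cong[OF \<open>\<theta> \<in> C\<close>] unfolding congruence_def by simp
  then show "(oper A f as, oper A f bs) \<in> \<Union>C" using \<open>\<theta> \<in> C\<close> by (rule UnionI[rotated])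
qed

text \<open>Zorn's lemma on the congruences that omit \<open>(x, y)\<close>; the equality relation, as the kernel of the
  identity, is one of them.\<close>

lemma ex_maximal_separating_congruence:
  assumes xy: "x \<noteq> y" "x \<in> carrier A" "y \<in> carrier A"
    and A: "is_algebra ar A"
  obtains \<theta> where "congruence ar A \<theta>" "(x, y) \<notin> \<theta>"
    "\<And>\<theta>'. congruence ar A \<theta>' \<Longrightarrow> \<theta> \<subseteq> \<theta>' \<Longrightarrow> (x, y) \<notin> \<theta>' \<Longrightarrow> \<theta>' = \<theta>"
proof -
  define S where "S = {\<theta>. congruence ar A \<theta> \<and> (x, y) \<notin> \<theta>}"
  have "is_hom ar A A id" unfolding is_hom_def by simp
  then have "hom_kernel A id \<in> S"
    using congruence_hom_kernel[OF A, of A id] xy unfolding S_def by (simp add: hom_kernel_def)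
  then have "S \<noteq> {}" by blast
  moreover have "\<Union>C \<in> S" if "C \<noteq> {}" "subset.chain S C" for C
  proof -
    have sub: "\<theta> \<in> S" if "\<theta> \<in> C" for \<theta>
      using \<open>subset.chain S C\<close> that unfolding subset.chain_def by auto
    have "subset.chain UNIV C" using that(2) unfolding subset.chain_def by auto
    then have "congruence ar A (\<Union>C)"
      using that(1) sub unfolding S_def by (intro congruence_Union_chain) auto
    then show ?thesis using sub unfolding S_def by auto
  qed
  ultimately have "\<exists>\<theta>\<in>S. \<forall>\<theta>'\<in>S. \<theta> \<subseteq> \<theta>' \<longrightarrow> \<theta>' = \<theta>" by (rule subset_Zorn_nonempty)
  then obtain \<theta> where "\<theta> \<in> S" and max: "\<forall>\<theta>'\<in>S. \<theta> \<subseteq> \<theta>' \<longrightarrow> \<theta>' = \<theta>" by (elim bexE)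
  show ?thesis
  proof (rule that)
    show "congruence ar A \<theta>" "(x, y) \<notin> \<theta>" using \<open>\<theta> \<in> S\<close> unfolding S_def by auto
    show "\<theta>' = \<theta>" if "congruence ar A \<theta>'" "\<theta> \<subseteq> \<theta>'" "(x, y) \<notin> \<theta>'" for \<theta>'
      using max that unfolding S_def by simp
  qed
qed

text \<open>The elements of the quotient are chosen representatives of the congruence classes instead of the
  classes themselves.  The quotient thus lives in the same type as \<open>A\<close>, as do all members of a
  variety and all factors of a subdirect representation.\<close>

lemma ex_quotient:
  fixes A :: "('f, 'u) algebra"
  assumes A: "is_algebra ar A" and \<theta>: "congruence ar A \<theta>"
  obtains Q and q :: "'u \<Rightarrow> 'u" where "is_algebra ar Q" "is_hom ar A Q q"
    "q ` carrier A = carrier Q" "hom_kernel A q = \<theta>"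
proof -
  have eq: "equiv (carrier A) \<theta>" using \<theta> unfolding congruence_def by blast
  define q where "q a = (SOME b. (a, b) \<in> \<theta>)" for a
  have q\<theta>: "(a, q a) \<in> \<theta>" if "a \<in> carrier A" for a
    unfolding q_def by (rule someI[of _ a]) (use that eq in \<open>auto simp: equiv_def refl_on_def\<close>)
  have qA: "q a \<in> carrier A" if "a \<in> carrier A" for a
    using q\<theta>[OF that] congruence_subset[OF \<theta>] by blast
  have q_eq: "q a = q b \<longleftrightarrow> (a, b) \<in> \<theta>" if "a \<in> carrier A" "b \<in> carrier A" for a b
  proof
    assume "q a = q b"
    then show "(a, b) \<in> \<theta>"
      using q\<theta>[OF that(1)] q\<theta>[OF that(2)] eq unfolding equiv_def sym_def trans_def by metis
  next
    assume "(a, b) \<in> \<theta>"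
    then have "\<And>c. (a, c) \<in> \<theta> \<longleftrightarrow> (b, c) \<in> \<theta>"
      using eq unfolding equiv_def sym_def trans_def by blast
    then show "q a = q b" unfolding q_def by simp
  qed
  define Q where "Q = \<lparr>carrier = q ` carrier A, oper = (\<lambda>f as. q (oper A f as))\<rparr>"
  have cQ: "carrier Q = q ` carrier A" and oQ: "oper Q f as = q (oper A f as)" for f as
    unfolding Q_def by simp_all
  have "is_algebra ar Q"
    unfolding is_algebra_def cQ oQ
  proof (intro conjI allI impI)
    show "q ` carrier A \<noteq> {}" using A unfolding is_algebra_def by blast
    fix f as assume "length as = ar f \<and> set as \<subseteq> q ` carrier A"
    then have "length as = ar f" "set as \<subseteq> carrier A" using qA by auto
    then show "q (oper A f as) \<in> q ` carrier A" using oper_in_carrier[OF A] by blast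
  qed
  moreover have "is_hom ar A Q q"
    unfolding is_hom_def cQ oQ
  proof (intro conjI allI impI)
    fix f as assume as: "length as = ar f \<and> set as \<subseteq> carrier A"
    then have qas: "set (map q as) \<subseteq> carrier A" using qA by (auto simp: subset_iff)
    have "list_all2 (\<lambda>a b. (a, b) \<in> \<theta>) as (map q as)"
      using as q\<theta> by (auto simp: list_all2_conv_all_nth subset_iff)
    then have "(oper A f as, oper A f (map q as)) \<in> \<theta>"
      using as \<theta> unfolding congruence_def by blast
    moreover have "oper A f as \<in> carrier A" "oper A f (map q as) \<in> carrier A"
      using as qas by (simp_all add: oper_in_carrier[OF A])
    ultimately show "q (oper A f as) = q (oper A f (map q as))" using q_eq by blast
  qed simp
  moreover have "hom_kernel A q = \<theta>"
    using q_eq congruence_subset[OF \<theta>] unfolding hom_kernel_def by blast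
  ultimately show ?thesis using that cQ by metis
qed

text \<open>In any subdirect representation some factor still separates the images of \<open>x\<close> and \<open>y\<close>.  The kernel
  of the map to this factor, pulled back to \<open>A\<close>, cannot exceed the maximal congruence omitting
  \<open>(x, y)\<close>, so this factor is an isomorphic copy.\<close>

lemma subdirectly_irreducible_quotient:
  assumes A: "is_algebra ar A" and Q: "is_algebra ar Q"
    and q: "is_hom ar A Q q" "q ` carrier A = carrier Q"
    and xy: "x \<in> carrier A" "y \<in> carrier A" "q x \<noteq> q y"
    and max: "\<And>\<theta>. congruence ar A \<theta> \<Longrightarrow> hom_kernel A q \<subseteq> \<theta> \<Longrightarrow> (x, y) \<notin> \<theta> \<Longrightarrow> \<theta> = hom_kernel A q"
  shows "subdirectly_irreducible ar Q"
  unfolding subdirectly_irreducible_def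
proof (intro conjI allI impI)
  fix R assume R: "subdirect_representation ar Q R"
  have "q x \<in> carrier Q" "q y \<in> carrier Q" using xy q by auto
  then obtain B h where Bh: "(B, h) \<in> R" and ne: "h (q x) \<noteq> h (q y)"
    using R xy(3) unfolding subdirect_representation_def by blast
  have h: "is_hom ar Q B h" "h ` carrier Q = carrier B"
    using bspec[OF conjunct1[OF R[unfolded subdirect_representation_def]] Bh] by simp_all
  have "hom_kernel A (h \<circ> q) = hom_kernel A q"
    using ne by (intro max congruence_hom_kernel[OF A hom_comp[OF q(1) h(1)]]) (auto simp: hom_kernel_def)
  then have "q a = q b" if "a \<in> carrier A" "b \<in> carrier A" "h (q a) = h (q b)" for a b
    using that unfolding hom_kernel_def set_eq_iff by auto
  then have "inj_on h (carrier Q)" unfolding q(2)[symmetric] by (auto intro!: inj_onI)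
  then have "is_iso ar Q B h" using h unfolding is_iso_def bij_betw_def by blast
  then show "\<exists>(B, h)\<in>R. is_iso ar Q B h" using Bh by blast
qed (rule Q)

text \<open>Birkhoff's subdirect representation theorem, in the form of a principle for proving two elements
  equal.\<close>

lemma eq_if_eq_in_subdirectly_irreducibles:
  fixes V :: "('f, 'u) algebra set"
  assumes V: "variety ar V" and A: "A \<in> V" and xy: "x \<in> carrier A" "y \<in> carrier A"
    and eq: "\<And>B (\<pi> :: 'u \<Rightarrow> 'u). B \<in> V \<Longrightarrow> subdirectly_irreducible ar B \<Longrightarrow> is_hom ar A B \<pi> \<Longrightarrow> \<pi> x = \<pi> y"
  shows "x = y"
proof (rule ccontr)
  assume "x \<noteq> y"
  have algA: "is_algebra ar A" using variety_is_algebra[OF V A] .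
  obtain \<theta> where \<theta>: "congruence ar A \<theta>" "(x, y) \<notin> \<theta>"
    and max: "\<And>\<theta>'. congruence ar A \<theta>' \<Longrightarrow> \<theta> \<subseteq> \<theta>' \<Longrightarrow> (x, y) \<notin> \<theta>' \<Longrightarrow> \<theta>' = \<theta>"
    using ex_maximal_separating_congruence[OF \<open>x \<noteq> y\<close> xy algA] by blast
  obtain Q and q :: "'u \<Rightarrow> 'u" where Q: "is_algebra ar Q" "is_hom ar A Q q"
    "q ` carrier A = carrier Q" and ker: "hom_kernel A q = \<theta>"
    using ex_quotient[OF algA \<theta>(1)] by blast
  have ne: "q x \<noteq> q y" using \<theta>(2) xy unfolding ker[symmetric] hom_kernel_def by blast
  have "subdirectly_irreducible ar Q"
    using subdirectly_irreducible_quotient[OF algA Q xy ne] max ker by blast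
  then show False using eq hom_image_in_variety[OF V A Q] Q(2) ne by blast
qed

section \<open>Finite presentation of finite quotients\<close>

text \<open>Fix a representative \<open>s a\<close> in \<open>F\<close> for every \<open>a\<close> in the image.  The pairs in \<open>P\<close> say that each
  generator equals its representative and that the representatives multiply as the elements of the
  image do.  By induction on the generation of \<open>w\<close>, a congruence that contains \<open>P\<close> identifies every
  \<open>w\<close> with \<open>s (h w)\<close>.\<close>

lemma finite_quotient_finitely_presented:
  assumes F: "is_algebra ar F" and gen: "generated_by ar F G" and finG: "finite G"
    and fin_type: "finite (UNIV :: 'f set)"
    and h: "is_hom (ar :: 'f \<Rightarrow> nat) F A h" and fin: "finite (h ` carrier F)"
  obtains P where "finite P" "P \<subseteq> hom_kernel F h"
    "\<And>\<theta>. congruence ar F \<theta> \<Longrightarrow> P \<subseteq> \<theta> \<Longrightarrow> hom_kernel F h \<subseteq> \<theta>"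
proof -
  define H where "H = h ` carrier F"
  define s where "s = inv_into (carrier F) h"
  have sF: "s a \<in> carrier F" and hs: "h (s a) = a" if "a \<in> H" for a
    using that unfolding s_def H_def by (auto intro: inv_into_into f_inv_into_f)
  have GF: "G \<subseteq> carrier F" using gen unfolding generated_by_def by blast
  have hH: "h w \<in> H" if "w \<in> carrier F" for w using that unfolding H_def by blast
  have HA: "H \<subseteq> carrier A" using hom_in_carrier[OF h] unfolding H_def by blast
  have opF: "oper F f (map s as) \<in> carrier F" and hop: "h (oper F f (map s as)) = oper A f as"
    if "length as = ar f" "set as \<subseteq> H" for f as
  proof -
    have s': "set (map s as) \<subseteq> carrier F" using that sF by auto
    then show "oper F f (map s as) \<in> carrier F" using that oper_in_carrier[OF F] by auto
    have "map h (map s as) = as" using that hs by (auto intro!: map_idI)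
    then show "h (oper F f (map s as)) = oper A f as" using hom_oper[OF h _ s', of f] that by simp
  qed
  define P where "P = (\<lambda>g. (g, s (h g))) ` G \<union>
    (\<Union>f. (\<lambda>as. (oper F f (map s as), s (oper A f as))) ` {as. set as \<subseteq> H \<and> length as = ar f})"
  show ?thesis
  proof (rule that)
    show "finite P"
      unfolding P_def using finG fin_type fin
      by (auto simp: H_def intro!: finite_lists_length_eq)
    have "(g, s (h g)) \<in> hom_kernel F h" if "g \<in> G" for g
      using that GF hH sF hs unfolding hom_kernel_def by auto
    moreover have "(oper F f (map s as), s (oper A f as)) \<in> hom_kernel F h"
      if "length as = ar f" "set as \<subseteq> H" for f as
      using opF[OF that] hop[OF that] hH[OF opF[OF that]] sF hs unfolding hom_kernel_def by auto
    ultimately show "P \<subseteq> hom_kernel F h" unfolding P_def by auto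
    fix \<theta> assume \<theta>: "congruence ar F \<theta>" and P: "P \<subseteq> \<theta>"
    have sym: "sym \<theta>" and trans: "trans \<theta>" using \<theta> unfolding congruence_def equiv_def by auto
    have rep: "(w, s (h w)) \<in> \<theta>" if "w \<in> carrier F" for w
    proof (rule generated_by_induct[OF gen that F])
      fix g assume "g \<in> G"
      then show "(g, s (h g)) \<in> \<theta>" using P unfolding P_def by blast
    next
      fix f ws assume ws: "length ws = ar f" "set ws \<subseteq> carrier F"
        and IH: "\<And>w. w \<in> set ws \<Longrightarrow> (w, s (h w)) \<in> \<theta>"
      have "list_all2 (\<lambda>a b. (a, b) \<in> \<theta>) ws (map s (map h ws))"
        using IH by (auto simp: list_all2_conv_all_nth)
      then have "(oper F f ws, oper F f (map s (map h ws))) \<in> \<theta>"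
        using \<theta> ws(1) unfolding congruence_def by blast
      moreover have "(oper F f (map s (map h ws)), s (oper A f (map h ws))) \<in> P"
      proof -
        have "map h ws \<in> {as. set as \<subseteq> H \<and> length as = ar f}" using ws hH by auto
        then show ?thesis unfolding P_def by blast
      qed
      ultimately show "(oper F f ws, s (h (oper F f ws))) \<in> \<theta>"
        using P trans hom_oper[OF h ws] unfolding trans_def by auto
    qed
    show "hom_kernel F h \<subseteq> \<theta>"
    proof
      fix p assume "p \<in> hom_kernel F h"
      then obtain u v where p: "p = (u, v)" "u \<in> carrier F" "v \<in> carrier F" "h u = h v"
        unfolding hom_kernel_def by auto
      then show "p \<in> \<theta>" using rep[of u] rep[of v] sym trans unfolding sym_def trans_def by metis
    qed
  qed
qed

section \<open>Atoms in finitely generated algebras\<close>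

lemma boolean_algebra_on_meet:
  assumes "boolean_algebra_on C jn mt cm zr on" "x \<in> C"
  shows "mt zr x = zr" "mt x zr = zr" "mt on x = x" "mt x on = x" "mt x x = x"
proof -
  note B = assms(1)[unfolded boolean_algebra_on_def]
  have C: "zr \<in> C" "on \<in> C" using B by blast+
  have "jn zr x = x" using B C assms(2) by metis
  then show zx: "mt zr x = zr" using B C assms(2) by metis
  then show "mt x zr = zr" using B C assms(2) by metis
  show xo: "mt x on = x" using B assms(2) by blast
  then show "mt on x = x" using B C assms(2) by metis
  have "jn x zr = x" using B assms(2) by blast
  then show "mt x x = x" using B C assms(2) by metis
qed

lemma boolean_algebra_on_ex_minimal_nonzero:
  assumes B: "boolean_algebra_on C jn mt cm zr on"
    and H: "H \<subseteq> C" "finite H" and b: "b \<in> H" "b \<noteq> zr"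
  obtains a where "a \<in> H" "a \<noteq> zr" "mt a b = a"
    "\<And>x. x \<in> H \<Longrightarrow> x \<noteq> zr \<Longrightarrow> mt x a = x \<Longrightarrow> x = a"
proof -
  have assoc: "mt (mt x y) z = mt x (mt y z)" and comm: "mt x y = mt y x"
    if "x \<in> H" "y \<in> H" "z \<in> H" for x y z
    using B H(1) that unfolding boolean_algebra_on_def by blast+
  define R where "R x y \<longleftrightarrow> mt x y = x \<and> x \<noteq> y" for x y
  define S where "S = {x \<in> H. x \<noteq> zr \<and> mt x b = x}"
  have "b \<in> S" using b boolean_algebra_on_meet(5)[OF B] H unfolding S_def by blast
  moreover have "finite S" "S \<subseteq> H" using H unfolding S_def by auto
  moreover have "asymp_on S R"
    using comm \<open>S \<subseteq> H\<close> unfolding asymp_on_def R_def by (metis subsetD)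
  moreover have "transp_on S R"
    unfolding transp_on_def
  proof (intro ballI impI)
    fix x y z assume "x \<in> S" "y \<in> S" "z \<in> S" and R: "R x y" "R y z"
    then have H: "x \<in> H" "y \<in> H" "z \<in> H" using \<open>S \<subseteq> H\<close> by auto
    have "mt x z = x" using assoc[OF H] R unfolding R_def by metis
    moreover have "x \<noteq> z" using R comm[OF H(1,2,2)] unfolding R_def by metis
    ultimately show "R x z" unfolding R_def by blast
  qed
  ultimately obtain a where a: "a \<in> S" and min: "\<And>x. x \<in> S \<Longrightarrow> x \<noteq> a \<Longrightarrow> \<not> R x a"
    using Finite_Set.bex_min_element[of S R] by blast
  have "x = a" if x: "x \<in> H" "x \<noteq> zr" "mt x a = x" for x
  proof -
    have "mt x b = x" using assoc[of x a b] x a b unfolding S_def by auto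
    then have "x \<in> S" using x unfolding S_def by blast
    then show "x = a" using min[of x] x unfolding R_def by blast
  qed
  then show ?thesis using that[of a] a unfolding S_def by blast
qed

text \<open>The element \<open>d\<close> is the meet of the \<open>\<sigma>(x, y, 1, 0)\<close> with \<open>(x, y) \<in> P\<close>.  It is a characteristic
  function: in the subdirectly irreducible factors of \<open>F\<close> it records whether the equations \<open>P\<close>
  hold.\<close>

lemma ex_equality_test:
  fixes V :: "('f, 'u) algebra set"
  assumes V: "variety ar V" and bool: "has_boolean_reduct ar V jn mt cm zr on"
    and \<sigma>: "wf_trm ar \<sigma>" "vars \<sigma> \<subseteq> {0, 1, 2, 3}"
      "\<And>B. B \<in> V \<Longrightarrow> subdirectly_irreducible ar B \<Longrightarrow> switching_term B \<sigma>"
    and F: "F \<in> V" and P: "finite P" "P \<subseteq> carrier F \<times> carrier F"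
  shows "\<exists>d\<in>carrier F. \<forall>B \<pi>. B \<in> V \<longrightarrow> subdirectly_irreducible ar B \<longrightarrow> is_hom ar F B (\<pi> :: 'u \<Rightarrow> 'u) \<longrightarrow>
    \<pi> d = (if P \<subseteq> hom_kernel F \<pi> then oper B on [] else oper B zr [])"
proof -
  have ar: "ar mt = 2" "ar zr = 0" "ar on = 0" using bool unfolding has_boolean_reduct_def by auto
  have algF: "is_algebra ar F" using variety_is_algebra[OF V F] .
  have const: "oper B c [] \<in> carrier B" if "B \<in> V" "ar c = 0" for B c
    using oper_in_carrier[OF variety_is_algebra[OF V that(1)], of "[]"] that by simp
  have hom_const: "\<pi> (oper F c []) = oper B c []" if "is_hom ar F B \<pi>" "ar c = 0" 
    for B c and \<pi> :: "'u \<Rightarrow> 'u"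
    using hom_oper[OF that(1), of "[]"] that by simp
  note zr = const[OF _ ar(2)] and on = const[OF _ ar(3)]
  note hom_zr = hom_const[OF _ ar(2)] and hom_on = hom_const[OF _ ar(3)]
  show ?thesis using P
  proof (induction P)
    case empty
    show ?case using on[OF F] hom_on by auto
  next
    case (insert p P)
    obtain x y where p: "p = (x, y)" and x: "x \<in> carrier F" and y: "y \<in> carrier F"
      using insert.prems by auto
    obtain d where d: "d \<in> carrier F" and \<pi>d: "\<And>B \<pi>. B \<in> V \<Longrightarrow> subdirectly_irreducible ar B \<Longrightarrow>
      is_hom ar F B (\<pi> :: 'u \<Rightarrow> 'u) \<Longrightarrow> \<pi> d = (if P \<subseteq> hom_kernel F \<pi> then oper B on [] else oper B zr [])"
      using insert by auto
    define \<rho> where "\<rho> n = [x, y, oper F on [], oper F zr []] ! n" for n :: nat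
    define e where "e = trm_value F \<rho> \<sigma>"
    have \<rho>F: "\<rho> n \<in> carrier F" if "n \<in> vars \<sigma>" for n
      using \<sigma>(2) that x y on[OF F] zr[OF F] unfolding \<rho>_def by (auto simp: eval_nat_numeral)
    then have e: "e \<in> carrier F" unfolding e_def by (rule trm_value_in_carrier[OF algF \<sigma>(1)])
    have \<pi>e: "\<pi> e = (if \<pi> x = \<pi> y then oper B on [] else oper B zr [])"
      if B: "B \<in> V" "subdirectly_irreducible ar B" and \<pi>: "is_hom ar F B \<pi>" for B and \<pi> :: "'u \<Rightarrow> 'u"
    proof -
      have "\<pi> e = trm_value B (\<pi> \<circ> \<rho>) \<sigma>"
        unfolding e_def by (rule hom_trm_value[OF algF \<pi> \<sigma>(1) \<rho>F])
      also have "\<dots> = trm_value B (\<lambda>n. [\<pi> x, \<pi> y, oper B on [], oper B zr []] ! n) \<sigma>"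
        by (rule trm_value_cong_vars)
          (use \<sigma>(2) hom_on[OF \<pi>] hom_zr[OF \<pi>] in \<open>auto simp: \<rho>_def eval_nat_numeral\<close>)
      also have "\<dots> = (if \<pi> x = \<pi> y then oper B on [] else oper B zr [])"
        using \<sigma>(3)[OF B] hom_in_carrier[OF \<pi>] x y on[OF B(1)] zr[OF B(1)]
        unfolding switching_term_def by blast
      finally show ?thesis .
    qed
    show ?case
    proof (intro bexI allI impI)
      show "oper F mt [e, d] \<in> carrier F" using oper_in_carrier[OF algF, of "[e, d]"] ar e d by simp
      fix B and \<pi> :: "'u \<Rightarrow> 'u"
      assume B: "B \<in> V" "subdirectly_irreducible ar B" and \<pi>: "is_hom ar F B \<pi>"
      have "boolean_algebra_on (carrier B) (\<lambda>x y. oper B jn [x, y]) (\<lambda>x y. oper B mt [x, y])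
        (\<lambda>x. oper B cm [x]) (oper B zr []) (oper B on [])"
        using bool B(1) unfolding has_boolean_reduct_def by blast
      note meet = boolean_algebra_on_meet[OF this]
      have "\<pi> (oper F mt [e, d]) = oper B mt [\<pi> e, \<pi> d]"
        using hom_oper[OF \<pi>, of "[e, d]"] ar e d by simp
      then show "\<pi> (oper F mt [e, d]) =
          (if insert p P \<subseteq> hom_kernel F \<pi> then oper B on [] else oper B zr [])"
        using meet[OF on[OF B(1)]] meet[OF zr[OF B(1)]] x y unfolding \<pi>e[OF B \<pi>] \<pi>d[OF B \<pi>] p
        by (auto simp: hom_kernel_def)
    qed
  qed
qed

text \<open>The atom \<open>c\<close> is the meet of the equality test for a finite presentation of \<open>h(F)\<close> and a preimage
  of an atom \<open>a \<le> h b\<close> of \<open>h(F)\<close>.  The equality test cuts down to the subdirectly irreducible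
  quotients of \<open>F\<close> that are quotients of \<open>h(F)\<close> as well, and there \<open>c\<close> inherits minimality from
  \<open>a\<close>.\<close>

lemma ex_atom_below_if_nonzero_in_finite_quotient:
  fixes V :: "('f, 'u) algebra set"
  assumes disc: "discriminator_variety ar V"
    and bool: "has_boolean_reduct ar V jn mt cm zr on"
    and fin_type: "finite (UNIV :: 'f set)"
    and F: "F \<in> V" and gen: "generated_by ar F G" "finite G"
    and A: "A \<in> V" and h: "is_hom ar F A (h :: 'u \<Rightarrow> 'u)" and fin: "finite (h ` carrier F)"
    and b: "b \<in> carrier F" and hb: "h b \<noteq> oper A zr []"
  shows "\<exists>a. is_atom mt zr F a \<and> bool_le mt F a b"
proof -
  have V: "variety ar V" using disc unfolding discriminator_variety_def by blast
  obtain \<sigma> where \<sigma>: "wf_trm ar \<sigma>" "vars \<sigma> \<subseteq> {0, 1, 2, 3}"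
      "\<And>B. B \<in> V \<Longrightarrow> subdirectly_irreducible ar B \<Longrightarrow> switching_term B \<sigma>"
    using disc unfolding discriminator_variety_def by blast
  have ar: "ar mt = 2" "ar zr = 0" "ar on = 0" using bool unfolding has_boolean_reduct_def by auto
  have BA: "boolean_algebra_on (carrier B) (\<lambda>x y. oper B jn [x, y]) (\<lambda>x y. oper B mt [x, y])
        (\<lambda>x. oper B cm [x]) (oper B zr []) (oper B on [])" if "B \<in> V" for B
    using bool that unfolding has_boolean_reduct_def by blast
  note meet = boolean_algebra_on_meet[OF BA]
  have algF: "is_algebra ar F" using variety_is_algebra[OF V F] .
  have mtF: "oper F mt [u, v] \<in> carrier F" if "u \<in> carrier F" "v \<in> carrier F" for u v
    using oper_in_carrier[OF algF, of "[u, v]"] ar that by simp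
  have zrF: "oper F zr [] \<in> carrier F" using oper_in_carrier[OF algF, of "[]"] ar by simp
  have onA: "oper A on [] \<in> carrier A"
    using oper_in_carrier[OF variety_is_algebra[OF V A], of "[]"] ar by simp
  have hom_mt: "\<pi> (oper C mt [u, v]) = oper B mt [\<pi> u, \<pi> v]"
    if "is_hom ar C B \<pi>" "u \<in> carrier C" "v \<in> carrier C" for C B u v and \<pi> :: "'u \<Rightarrow> 'u"
    using hom_oper[OF that(1), of "[u, v]"] ar that by simp
  have hom_zr: "\<pi> (oper C zr []) = oper B zr []" and hom_on: "\<pi> (oper C on []) = oper B on []"
    if "is_hom ar C B \<pi>" for C B and \<pi> :: "'u \<Rightarrow> 'u"
    using hom_oper[OF that, of "[]"] ar by simp_all
  obtain P where P: "finite P" "P \<subseteq> hom_kernel F h"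
    and ker: "\<And>\<theta>. congruence ar F \<theta> \<Longrightarrow> P \<subseteq> \<theta> \<Longrightarrow> hom_kernel F h \<subseteq> \<theta>"
    using finite_quotient_finitely_presented[OF algF gen fin_type h fin] by blast
  have "P \<subseteq> carrier F \<times> carrier F" using P(2) unfolding hom_kernel_def by auto
  from ex_equality_test[OF V bool \<sigma> F P(1) this]
  obtain d where d: "d \<in> carrier F" and \<pi>d: "\<And>B \<pi>. B \<in> V \<Longrightarrow> subdirectly_irreducible ar B \<Longrightarrow>
      is_hom ar F B (\<pi> :: 'u \<Rightarrow> 'u) \<Longrightarrow> \<pi> d = (if P \<subseteq> hom_kernel F \<pi> then oper B on [] else oper B zr [])"
    by blast
  \<comment> \<open>\<open>A\<close> need not be subdirectly irreducible, so \<open>d\<close> is evaluated in the subdirectly irreducible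
    quotients of \<open>A\<close>, all of which satisfy the equations \<open>P\<close>.\<close>
  have hd1: "h d = oper A on []"
  proof (rule eq_if_eq_in_subdirectly_irreducibles[OF V A hom_in_carrier[OF h d] onA])
    fix B and \<psi> :: "'u \<Rightarrow> 'u"
    assume B: "B \<in> V" "subdirectly_irreducible ar B" and \<psi>: "is_hom ar A B \<psi>"
    have "P \<subseteq> hom_kernel F (\<psi> \<circ> h)" using P(2) unfolding hom_kernel_def by auto
    then show "\<psi> (h d) = \<psi> (oper A on [])"
      using \<pi>d[OF B hom_comp[OF h \<psi>]] hom_on[OF \<psi>] by simp
  qed
  have "h ` carrier F \<subseteq> carrier A" using hom_in_carrier[OF h] by blast
  then obtain a where aH: "a \<in> h ` carrier F" and a0: "a \<noteq> oper A zr []"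
    and ab: "oper A mt [a, h b] = a"
    and min: "\<And>x. x \<in> h ` carrier F \<Longrightarrow> x \<noteq> oper A zr [] \<Longrightarrow> oper A mt [x, a] = x \<Longrightarrow> x = a"
    using boolean_algebra_on_ex_minimal_nonzero[OF BA[OF A] _ fin imageI[OF b] hb] by blast
  obtain z where z: "z \<in> carrier F" and hz: "h z = a" using aH by blast
  define c where "c = oper F mt [d, z]"
  have c: "c \<in> carrier F" unfolding c_def using mtF d z by blast
  have hc: "h c = a"
    unfolding c_def hom_mt[OF h d z] hd1 hz using meet(3)[OF A] hom_in_carrier[OF h z] hz by simp
  have c0: "c \<noteq> oper F zr []" using hc a0 hom_zr[OF h] by auto
  \<comment> \<open>The dichotomy behind the three comparisons below: \<open>\<pi>\<close> kills \<open>c\<close> or factors through \<open>h\<close>.\<close>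
  have \<pi>c: "\<pi> c = oper B zr [] \<or> (\<forall>u\<in>carrier F. \<forall>v\<in>carrier F. h u = h v \<longrightarrow> \<pi> u = \<pi> v)"
    if B: "B \<in> V" "subdirectly_irreducible ar B" and \<pi>: "is_hom ar F B \<pi>" for B and \<pi> :: "'u \<Rightarrow> 'u"
  proof (cases "P \<subseteq> hom_kernel F \<pi>")
    case True
    then have "hom_kernel F h \<subseteq> hom_kernel F \<pi>" using ker congruence_hom_kernel[OF algF \<pi>] by blast
    then show ?thesis unfolding hom_kernel_def by blast
  next
    case False
    then have "\<pi> d = oper B zr []" using \<pi>d[OF B \<pi>] by simp
    then show ?thesis unfolding c_def hom_mt[OF \<pi> d z] 
      using meet(1)[OF B(1) hom_in_carrier[OF \<pi> z]] by simp
  qed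
  have "oper F mt [c, b] = c"
  proof (rule eq_if_eq_in_subdirectly_irreducibles[OF V F mtF[OF c b] c])
    fix B and \<pi> :: "'u \<Rightarrow> 'u"
    assume B: "B \<in> V" "subdirectly_irreducible ar B" and \<pi>: "is_hom ar F B \<pi>"
    have hcb: "h (oper F mt [c, b]) = h c" using hom_mt[OF h c b] hc ab by simp
    from \<pi>c[OF B \<pi>] show "\<pi> (oper F mt [c, b]) = \<pi> c"
    proof
      assume "\<pi> c = oper B zr []"
      then show ?thesis
        using hom_mt[OF \<pi> c b] meet(1)[OF B(1) hom_in_carrier[OF \<pi> b]] by simp
    next
      assume "\<forall>u\<in>carrier F. \<forall>v\<in>carrier F. h u = h v \<longrightarrow> \<pi> u = \<pi> v"
      then show ?thesis using mtF[OF c b] c hcb by blast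
    qed
  qed
  moreover have "x = c" if x: "x \<in> carrier F" "x \<noteq> oper F zr []" and xc: "oper F mt [x, c] = x" for x
  proof -
    have \<pi>x: "\<pi> x = oper B zr []" if "B \<in> V" "is_hom ar F B \<pi>" "\<pi> c = oper B zr []"
      for B and \<pi> :: "'u \<Rightarrow> 'u"
      using hom_mt[OF that(2) x(1) c] that(3) meet(2)[OF that(1) hom_in_carrier[OF that(2) x(1)]] xc
      by simp
    have "h x \<noteq> oper A zr []"
    proof
      assume hx: "h x = oper A zr []"
      have "x = oper F zr []"
      proof (rule eq_if_eq_in_subdirectly_irreducibles[OF V F x(1) zrF])
        fix B and \<pi> :: "'u \<Rightarrow> 'u"
        assume B: "B \<in> V" "subdirectly_irreducible ar B" and \<pi>: "is_hom ar F B \<pi>"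
        show "\<pi> x = \<pi> (oper F zr [])"
          using \<pi>c[OF B \<pi>]
        proof
          assume "\<pi> c = oper B zr []"
          then show ?thesis using \<pi>x[OF B(1) \<pi>] hom_zr[OF \<pi>] by simp
        next
          assume "\<forall>u\<in>carrier F. \<forall>v\<in>carrier F. h u = h v \<longrightarrow> \<pi> u = \<pi> v"
          then show ?thesis using hx hom_zr[OF h] x(1) zrF by metis
        qed
      qed
      then show False using x(2) by blast
    qed
    then have hx: "h x = a" using min[OF imageI[OF x(1)]] hom_mt[OF h x(1) c] hc xc by simp
    show "x = c"
    proof (rule eq_if_eq_in_subdirectly_irreducibles[OF V F x(1) c])
      fix B and \<pi> :: "'u \<Rightarrow> 'u"
      assume B: "B \<in> V" "subdirectly_irreducible ar B" and \<pi>: "is_hom ar F B \<pi>"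
      show "\<pi> x = \<pi> c"
        using \<pi>c[OF B \<pi>]
      proof
        assume "\<pi> c = oper B zr []"
        then show ?thesis using \<pi>x[OF B(1) \<pi>] by simp
      next
        assume "\<forall>u\<in>carrier F. \<forall>v\<in>carrier F. h u = h v \<longrightarrow> \<pi> u = \<pi> v"
        then show ?thesis using hx hc x(1) c by metis
      qed
    qed
  qed
  ultimately show ?thesis using c c0 unfolding is_atom_def bool_le_def by blast
qed

section \<open>Finite quotients of free algebras\<close>

text \<open>Otherwise the equation would define a variety that contains all finite members of \<open>V\<close> but
  not \<open>A\<close>.\<close>

lemma ex_finite_member_refuting:
  assumes gen: "generated_by_finite_members ar V"
    and e: "wf_equation ar e" and A: "A \<in> V" "\<not> satisfies A e"
  shows "\<exists>B\<in>finite_members V. \<not> satisfies B e"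
proof (rule ccontr)
  assume "\<not> ?thesis"
  moreover have "is_algebra ar B" if "B \<in> finite_members V" for B
    using gen that variety_is_algebra unfolding generated_by_finite_members_def finite_members_def
    by blast
  ultimately have "finite_members V \<subseteq> models ar {e}" unfolding models_def by blast
  moreover have "variety ar (models ar {e})" using e unfolding variety_def by blast
  ultimately have "V \<subseteq> models ar {e}" using gen unfolding generated_by_finite_members_def by blast
  then show False using A unfolding models_def by blast
qed

lemma generated_by_ex_trm:
  assumes alg: "is_algebra ar A" and gen: "generated_by ar A (\<rho> ` N)" and a: "a \<in> carrier A"
  shows "\<exists>t. wf_trm ar t \<and> vars t \<subseteq> N \<and> trm_value A \<rho> t = a"
proof (rule generated_by_induct[OF gen a alg])
  fix g assume "g \<in> \<rho> ` N"
  then obtain n where "n \<in> N" "g = \<rho> n" by blast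
  then show "\<exists>t. wf_trm ar t \<and> vars t \<subseteq> N \<and> trm_value A \<rho> t = g"
    by (intro exI[of _ "Var n"]) simp
next
  fix f as
  assume len: "length as = ar f"
    and "\<And>a. a \<in> set as \<Longrightarrow> \<exists>t. wf_trm ar t \<and> vars t \<subseteq> N \<and> trm_value A \<rho> t = a"
  then obtain T where T: "\<And>a. a \<in> set as \<Longrightarrow> wf_trm ar (T a) \<and> vars (T a) \<subseteq> N \<and> trm_value A \<rho> (T a) = a"
    by metis
  have "map (trm_value A \<rho>) (map T as) = as" using T by (simp add: map_idI)
  then have "trm_value A \<rho> (App f (map T as)) = oper A f as" by (simp only: trm_value.simps)
  moreover have "wf_trm ar (App f (map T as))" "vars (App f (map T as)) \<subseteq> N" using len T by auto
  ultimately show "\<exists>t. wf_trm ar t \<and> vars t \<subseteq> N \<and> trm_value A \<rho> t = oper A f as" by blast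
qed

text \<open>Two distinct elements are the values of two terms, and the equation between these terms fails in a
  finite member under some assignment, which freeness extends to a homomorphism.  Equations use
  variables from \<open>nat\<close>, so the generators are first numbered.\<close>

lemma free_algebra_separated_by_finite_members:
  fixes V :: "('f, 'u) algebra set"
  assumes fin: "generated_by_finite_members ar V" and X: "countable X"
    and free: "free_algebra ar V X \<eta> F"
    and ab: "a \<in> carrier F" "b \<in> carrier F" "a \<noteq> b"
  shows "\<exists>A\<in>finite_members V. \<exists>h. is_hom ar F A h \<and> h a \<noteq> h b"
proof -
  have V: "variety ar V" using fin unfolding generated_by_finite_members_def by blast
  have F: "F \<in> V" and gen: "generated_by ar F (\<eta> ` X)"
    and univ: "\<And>A g. A \<in> V \<Longrightarrow> g ` X \<subseteq> carrier A \<Longrightarrow> \<exists>h. is_hom ar F A h \<and> (\<forall>x\<in>X. h (\<eta> x) = g x)"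
    using free unfolding free_algebra_def by auto
  have algF: "is_algebra ar F" using variety_is_algebra[OF V F] .
  define k where "k = to_nat_on X"
  have inj: "inj_on k X" unfolding k_def using inj_on_to_nat_on[OF X] .
  \<comment> \<open>Numbers that code no generator get the arbitrary value \<open>a\<close>, since an assignment refuting an
    equation in \<open>F\<close> has to stay in the carrier everywhere.\<close>
  define \<rho> where "\<rho> n = (if n \<in> k ` X then \<eta> (inv_into X k n) else a)" for n
  have \<rho>k: "\<rho> (k x) = \<eta> x" if "x \<in> X" for x using that inj unfolding \<rho>_def by simp
  then have img: "\<rho> ` k ` X = \<eta> ` X" by (simp add: image_image)
  have \<eta>F: "\<eta> x \<in> carrier F" if "x \<in> X" for x using gen that unfolding generated_by_def by blast
  then have \<rho>F: "\<rho> n \<in> carrier F" for n unfolding \<rho>_def using ab(1) by (auto simp: inv_into_into)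
  obtain s t where s: "wf_trm ar s" "vars s \<subseteq> k ` X" "trm_value F \<rho> s = a"
    and t: "wf_trm ar t" "vars t \<subseteq> k ` X" "trm_value F \<rho> t = b"
    using generated_by_ex_trm[OF algF gen[folded img]] ab by metis
  have "wf_equation ar (s, t)" using s t unfolding wf_equation_def by simp
  moreover have "\<not> satisfies F (s, t)" using \<rho>F s t ab(3) unfolding satisfies_def by auto
  ultimately obtain A where A: "A \<in> finite_members V" and nA: "\<not> satisfies A (s, t)"
    using ex_finite_member_refuting[OF fin _ F] by blast
  obtain \<tau> where \<tau>: "range \<tau> \<subseteq> carrier A" and ne: "trm_value A \<tau> s \<noteq> trm_value A \<tau> t"
    using nA unfolding satisfies_def by auto
  have "A \<in> V" using A unfolding finite_members_def by blast
  moreover have "(\<tau> \<circ> k) ` X \<subseteq> carrier A" using \<tau> by auto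
  ultimately obtain h where h: "is_hom ar F A h" and h\<eta>: "\<And>x. x \<in> X \<Longrightarrow> h (\<eta> x) = \<tau> (k x)"
    using univ[of A "\<tau> \<circ> k"] by auto
  have "h (trm_value F \<rho> r) = trm_value A \<tau> r" if "wf_trm ar r" "vars r \<subseteq> k ` X" for r
  proof -
    have "h (trm_value F \<rho> r) = trm_value A (h \<circ> \<rho>) r"
      by (rule hom_trm_value[OF algF h that(1) \<rho>F])
    also have "\<dots> = trm_value A \<tau> r"
      by (rule trm_value_cong_vars) (use that(2) \<rho>k h\<eta> in auto)
    finally show ?thesis .
  qed
  then have "h a \<noteq> h b" using s t ne by metis
  then show ?thesis using A h by blast
qed

theorem theorem2:
  fixes ar :: "'f \<Rightarrow> nat"
    and V :: "('f, 'u) algebra set"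
    and jn mt cm zr on :: 'f
    and X :: "'x set"
    and \<eta> :: "'x \<Rightarrow> 'u"
    and F :: "('f, 'u) algebra"
  assumes "infinite (UNIV :: 'u set)"
    and "discriminator_variety ar V"
    and "generated_by_finite_members ar V"
    and "has_boolean_reduct ar V jn mt cm zr on"
    and "finite (UNIV :: 'f set)"
    and "finite X"
    and "free_algebra ar V X \<eta> F"
  shows "atomic mt zr F"
  unfolding atomic_def
proof (intro ballI impI)
  fix b assume b: "b \<in> carrier F" "b \<noteq> oper F zr []"
  have V: "variety ar V" using assms(2) unfolding discriminator_variety_def by blast
  have F: "F \<in> V" and gen: "generated_by ar F (\<eta> ` X)"
    using assms(7) unfolding free_algebra_def by auto
  have ar: "ar zr = 0" using assms(4) unfolding has_boolean_reduct_def by blast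
  have zrF: "oper F zr [] \<in> carrier F"
    using oper_in_carrier[OF variety_is_algebra[OF V F], of "[]"] ar by simp
  obtain A h where A: "A \<in> V" "finite (carrier A)" and h: "is_hom ar F A h"
    and ne: "h b \<noteq> h (oper F zr [])"
    using free_algebra_separated_by_finite_members[OF assms(3) countable_finite[OF assms(6)] assms(7)
        b(1) zrF b(2)] unfolding finite_members_def by blast
  have "h b \<noteq> oper A zr []" using ne hom_oper[OF h, of "[]" zr] ar by simp
  moreover have "finite (h ` carrier F)"
    using A(2) h unfolding is_hom_def by (metis finite_subset)
  ultimately show "\<exists>a. is_atom mt zr F a \<and> bool_le mt F a b"
    using ex_atom_below_if_nonzero_in_finite_quotient[OF assms(2,4,5) F gen finite_imageI[OF assms(6)] A(1) h]
      b(1) by blast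
qed

end
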